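(* Let $K$ be a field of characteristic $0$ and let $\epsilon\in K$, $\epsilon\neq 0$, be such that $\epsilon^{-1}\notin\mathbf{Z}$ (the case of a formal parameter is included by taking $K=k(\epsilon)$). Let $V$ be the $K$-vector space with basis $\{e_p\mid p\in\mathbf{Z}\}\cup\{\theta\}$, and define a bilinear multiplication $*$ on $V$ by $$e_p * e_q = -\frac{q(1+\epsilon q)}{1+\epsilon(p+q)}\,e_{p+q}+\frac12\,\theta\left[p^3-p+\left(\epsilon-\epsilon^{-1}\right)p^2\right]\delta^0_{p+q},\qquad p,q\in\mathbf{Z},$$ $$e_p*\theta=\theta*e_p=0,\qquad \theta*\theta=0,$$ where $\delta^0_{n}$ equals $1$ if $n=0$ and $0$ otherwise. Then $(V,* )$ is a quasiassociative algebra, and its commutator $[a,b]=a*b-b*a$ is the multiplication of the Virasoro algebra: $$[e_p,e_q]=(p-q)e_{p+q}+\theta\,(p^3-p)\,\delta^0_{p+q},\qquad [\theta,e_p]=0,\qquad p,q\in\mathbf{Z}.$$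
   Context: An algebra $\mathcal{R}$ with bilinear multiplication $*$ is called quasiassociative if $a*(b*c)-(a*b)*c=b*(a*c)-(b*a)*c$ for all $a,b,c\in\mathcal{R}$. *)

theory Defs
  imports Complex_Main "HOL-Library.Poly_Mapping"
begin

text \<open>The vector space with basis indexed by \<open>'i\<close> is the type \<open>'i \<Rightarrow>\<^sub>0 'a\<close> of finitely
  supported functions; the basis vector with index \<open>i\<close> is \<open>Poly_Mapping.single i 1\<close>.\<close>

definition pscale :: "'a::field \<Rightarrow> ('i \<Rightarrow>\<^sub>0 'a) \<Rightarrow> ('i \<Rightarrow>\<^sub>0 'a)"  (infixr "*\<^sub>v" 75)
  where "c *\<^sub>v x = Poly_Mapping.map (\<lambda>a. c * a) x"

definition bilinear_ext ::
  "('i \<Rightarrow> 'i \<Rightarrow> ('i \<Rightarrow>\<^sub>0 'a::field)) \<Rightarrow> ('i \<Rightarrow>\<^sub>0 'a) \<Rightarrow> ('i \<Rightarrow>\<^sub>0 'a) \<Rightarrow> ('i \<Rightarrow>\<^sub>0 'a)"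
  where "bilinear_ext t x y =
    (\<Sum>i\<in>Poly_Mapping.keys x. \<Sum>j\<in>Poly_Mapping.keys y.
      (Poly_Mapping.lookup x i * Poly_Mapping.lookup y j) *\<^sub>v t i j)"

lemma lookup_pscale [simp]: "Poly_Mapping.lookup (c *\<^sub>v x) i = c * Poly_Mapping.lookup x i"
  unfolding pscale_def by (simp add: map.rep_eq when_def)

lemma vector_space_pscale: "vector_space (pscale :: 'a::field \<Rightarrow> ('i \<Rightarrow>\<^sub>0 'a) \<Rightarrow> _)"
  by unfold_locales (auto intro!: poly_mapping_eqI simp: lookup_add algebra_simps)

lemma bilinear_ext_single [simp]:
  "bilinear_ext t (Poly_Mapping.single i 1) (Poly_Mapping.single j 1) = t i j"
  unfolding bilinear_ext_def by (auto intro!: poly_mapping_eqI)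

lemma bilinear_ext_superset:
  assumes "finite A" "Poly_Mapping.keys x \<subseteq> A" "finite B" "Poly_Mapping.keys y \<subseteq> B"
  shows "bilinear_ext t x y =
    (\<Sum>i\<in>A. \<Sum>j\<in>B. (Poly_Mapping.lookup x i * Poly_Mapping.lookup y j) *\<^sub>v t i j)"
proof -
  have z: "0 *\<^sub>v u = 0" for u :: "'a \<Rightarrow>\<^sub>0 'b"
    by (auto intro!: poly_mapping_eqI)
  have "bilinear_ext t x y =
    (\<Sum>i\<in>Poly_Mapping.keys x. \<Sum>j\<in>B. (Poly_Mapping.lookup x i * Poly_Mapping.lookup y j) *\<^sub>v t i j)"
    unfolding bilinear_ext_def using assms
    by (intro sum.cong refl sum.mono_neutral_left) (auto simp: in_keys_iff z)
  also have "\<dots> = (\<Sum>i\<in>A. \<Sum>j\<in>B. (Poly_Mapping.lookup x i * Poly_Mapping.lookup y j) *\<^sub>v t i j)"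
    using assms by (intro sum.mono_neutral_left) (auto simp: in_keys_iff z)
  finally show ?thesis .
qed

locale bilinear_algebra = vector_space scale
  for scale :: "'a::field \<Rightarrow> 'v::ab_group_add \<Rightarrow> 'v" +
  fixes mult :: "'v \<Rightarrow> 'v \<Rightarrow> 'v"
  assumes linear_right: "Vector_Spaces.linear scale scale (\<lambda>y. mult x y)"
    and linear_left: "Vector_Spaces.linear scale scale (\<lambda>x. mult x y)"

locale quasiassociative_algebra = bilinear_algebra scale mult
  for scale :: "'a::field \<Rightarrow> 'v::ab_group_add \<Rightarrow> 'v" and mult :: "'v \<Rightarrow> 'v \<Rightarrow> 'v" +
  assumes quasiassociative:
    "mult a (mult b c) - mult (mult a b) c = mult b (mult a c) - mult (mult b a) c"

definition commutator :: "('v \<Rightarrow> 'v \<Rightarrow> 'v::ab_group_add) \<Rightarrow> 'v \<Rightarrow> 'v \<Rightarrow> 'v"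
  where "commutator mult a b = mult a b - mult b a"

lemma bilinear_algebra_bilinear_ext: "bilinear_algebra pscale (bilinear_ext (t :: 'a \<Rightarrow> 'a \<Rightarrow> ('a \<Rightarrow>\<^sub>0 'b::field)))"
proof -
  interpret vector_space "pscale :: 'b \<Rightarrow> ('a \<Rightarrow>\<^sub>0 'b) \<Rightarrow> _" by (rule vector_space_pscale)
  have L: "Vector_Spaces.linear pscale pscale f"
    if "\<And>x y. f (x + y) = f x + f y" "\<And>c x. f (c *\<^sub>v x) = c *\<^sub>v f x"
    for f :: "('a \<Rightarrow>\<^sub>0 'b) \<Rightarrow> ('a \<Rightarrow>\<^sub>0 'b)"
    using that by unfold_locales auto
  let ?k = Poly_Mapping.keys and ?l = Poly_Mapping.lookup
  have ks: "?k (c *\<^sub>v x) \<subseteq> ?k x" for c and x :: "'a \<Rightarrow>\<^sub>0 'b"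
    by (auto simp: in_keys_iff)
  show ?thesis
  proof (unfold_locales, goal_cases)
    case (1 x b1 b2)
    let ?B = "?k b1 \<union> ?k b2"
    have "bilinear_ext t x v = (\<Sum>i\<in>?k x. \<Sum>j\<in>?B. (?l x i * ?l v j) *\<^sub>v t i j)"
      if "?k v \<subseteq> ?B" for v
      using that by (intro bilinear_ext_superset) auto
    from this[of b1] this[of b2] this[of "b1 + b2"] show ?case
      by (simp add: Poly_Mapping.keys_add lookup_add distrib_left scale_left_distrib sum.distrib)
  next
    case (2 x r b)
    have "bilinear_ext t x (r *\<^sub>v b) = (\<Sum>i\<in>?k x. \<Sum>j\<in>?k b. (?l x i * ?l (r *\<^sub>v b) j) *\<^sub>v t i j)"
      by (intro bilinear_ext_superset ks) auto
    then show ?case by (simp add: bilinear_ext_def scale_sum_right mult_ac)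
  next
    case (3 y b1 b2)
    let ?B = "?k b1 \<union> ?k b2"
    have "bilinear_ext t v y = (\<Sum>i\<in>?B. \<Sum>j\<in>?k y. (?l v i * ?l y j) *\<^sub>v t i j)"
      if "?k v \<subseteq> ?B" for v
      using that by (intro bilinear_ext_superset) auto
    from this[of b1] this[of b2] this[of "b1 + b2"] show ?case
      by (simp add: Poly_Mapping.keys_add lookup_add distrib_right scale_left_distrib sum.distrib)
  next
    case (4 y r b)
    have "bilinear_ext t (r *\<^sub>v b) y = (\<Sum>i\<in>?k b. \<Sum>j\<in>?k y. (?l (r *\<^sub>v b) i * ?l y j) *\<^sub>v t i j)"
      by (intro bilinear_ext_superset ks) auto
    then show ?case by (simp add: bilinear_ext_def scale_sum_right mult_ac)
  qed
qed

datatype vindex = E int | Theta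

type_synonym 'a vspace = "vindex \<Rightarrow>\<^sub>0 'a"

definition e :: "int \<Rightarrow> 'a::field vspace"
  where "e p = Poly_Mapping.single (E p) 1"

definition \<theta> :: "'a::field vspace"
  where "\<theta> = Poly_Mapping.single Theta 1"

definition kdelta0 :: "int \<Rightarrow> 'a::field"
  where "kdelta0 n = (if n = 0 then 1 else 0)"

fun star_table :: "'a::field \<Rightarrow> vindex \<Rightarrow> vindex \<Rightarrow> 'a vspace" where
  "star_table \<epsilon> (E p) (E q) =
     (- (of_int q * (1 + \<epsilon> * of_int q) / (1 + \<epsilon> * of_int (p + q)))) *\<^sub>v e (p + q)
     + (1 / 2 * (of_int p ^ 3 - of_int p + (\<epsilon> - inverse \<epsilon>) * of_int p ^ 2)
         * kdelta0 (p + q)) *\<^sub>v \<theta>"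
| "star_table \<epsilon> (E p) Theta = 0"
| "star_table \<epsilon> Theta (E p) = 0"
| "star_table \<epsilon> Theta Theta = 0"

definition star :: "'a::field \<Rightarrow> 'a vspace \<Rightarrow> 'a vspace \<Rightarrow> 'a vspace"
  where "star \<epsilon> = bilinear_ext (star_table \<epsilon>)"

fun virasoro_table :: "vindex \<Rightarrow> vindex \<Rightarrow> 'a::field vspace" where
  "virasoro_table (E p) (E q) =
     of_int (p - q) *\<^sub>v e (p + q) + ((of_int p ^ 3 - of_int p) * kdelta0 (p + q)) *\<^sub>v \<theta>"
| "virasoro_table (E p) Theta = 0"
| "virasoro_table Theta (E p) = 0"
| "virasoro_table Theta Theta = 0"

definition virasoro_bracket :: "'a::field vspace \<Rightarrow> 'a vspace \<Rightarrow> 'a vspace"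
  where "virasoro_bracket = bilinear_ext virasoro_table"

lemma basis_distinct:
  "inj (e :: int \<Rightarrow> 'a::field vspace)" "(\<theta> :: 'a vspace) \<notin> range e"
proof -
  have "p = q" if "(e p :: 'a vspace) = e q" for p q
    using arg_cong[OF that, of "\<lambda>x. Poly_Mapping.lookup x (E p)"]
    by (simp add: e_def lookup_single when_def split: if_splits)
  then show "inj (e :: int \<Rightarrow> 'a vspace)" by (rule injI)
  have "False" if "(\<theta> :: 'a vspace) = e q" for q
    using arg_cong[OF that, of "\<lambda>x. Poly_Mapping.lookup x Theta"]
    by (simp add: e_def \<theta>_def lookup_single)
  then show "(\<theta> :: 'a vspace) \<notin> range e" by auto
qed

lemma single_cases: "Poly_Mapping.single i (1::'a::field) \<in> insert \<theta> (range e)"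
  by (cases i) (auto simp: e_def \<theta>_def)

lemma basis_span:
  "module.span pscale (insert \<theta> (range e)) = (UNIV :: 'a::field vspace set)"
proof -
  interpret vector_space "pscale :: 'a \<Rightarrow> 'a vspace \<Rightarrow> _" by (rule vector_space_pscale)
  have "x \<in> span (insert \<theta> (range e))" for x :: "'a vspace"
  proof -
    have "x = (\<Sum>i\<in>Poly_Mapping.keys x. Poly_Mapping.lookup x i *\<^sub>v Poly_Mapping.single i 1)"
    proof (rule poly_mapping_eqI)
      fix k
      show "Poly_Mapping.lookup x k = Poly_Mapping.lookup
        (\<Sum>i\<in>Poly_Mapping.keys x. Poly_Mapping.lookup x i *\<^sub>v Poly_Mapping.single i 1) k"
        by (simp add: lookup_sum lookup_single when_def if_distrib in_keys_iff cong: if_cong)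
    qed
    also have "\<dots> \<in> span (insert \<theta> (range e))"
      by (intro span_sum span_scale span_base single_cases)
    finally show ?thesis .
  qed
  then show ?thesis by auto
qed

lemma basis_independent:
  "\<not> module.dependent pscale (insert \<theta> (range e) :: 'a::field vspace set)"
proof -
  interpret vector_space "pscale :: 'a \<Rightarrow> 'a vspace \<Rightarrow> _" by (rule vector_space_pscale)
  let ?s = "\<lambda>i. Poly_Mapping.single i (1::'a)"
  have r: "insert \<theta> (range e) = range ?s"
    using single_cases by (auto simp: e_def \<theta>_def)
  have inj: "inj ?s"
  proof (rule injI)
    fix i j assume "?s i = ?s j"
    from arg_cong[OF this, of "\<lambda>x. Poly_Mapping.lookup x i"] show "i = j"
      by (simp add: lookup_single when_def split: if_splits)
  qed
  have "u v = 0" if T: "finite T" "T \<subseteq> range ?s" "(\<Sum>v\<in>T. u v *\<^sub>v v) = 0" "v \<in> T" for T u v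
  proof -
    obtain i where i: "v = ?s i" using T by blast
    have "0 = Poly_Mapping.lookup (\<Sum>v\<in>T. u v *\<^sub>v v) i" using that by simp
    also have "\<dots> = (\<Sum>w\<in>T. if w = v then u v else 0)"
      unfolding lookup_sum
    proof (intro sum.cong refl)
      fix w assume "w \<in> T"
      then obtain j where j: "w = ?s j" using T by blast
      show "Poly_Mapping.lookup (u w *\<^sub>v w) i = (if w = v then u v else 0)"
        using injD[OF inj, of j i] by (auto simp: i j lookup_single when_def)
    qed
    also have "\<dots> = u v" using that by simp
    finally show ?thesis by simp
  qed
  then show ?thesis unfolding r dependent_explicit by blast
qed

lemma star_basis:
  "star \<epsilon> (e p) (e q) =
     (- (of_int q * (1 + \<epsilon> * of_int q) / (1 + \<epsilon> * of_int (p + q)))) *\<^sub>v e (p + q)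
     + (1 / 2 * (of_int p ^ 3 - of_int p + (\<epsilon> - inverse \<epsilon>) * of_int p ^ 2)
         * kdelta0 (p + q)) *\<^sub>v \<theta>"
  "star \<epsilon> (e p) \<theta> = 0" "star \<epsilon> \<theta> (e p) = 0" "star \<epsilon> \<theta> \<theta> = 0"
  unfolding star_def e_def[of p] e_def[of q] \<theta>_def bilinear_ext_single
  by (simp_all add: \<theta>_def)

lemma virasoro_bracket_basis:
  "virasoro_bracket (e p) (e q) =
     of_int (p - q) *\<^sub>v e (p + q) + ((of_int p ^ 3 - of_int p) * kdelta0 (p + q)) *\<^sub>v \<theta>"
  "virasoro_bracket (e p) \<theta> = 0" "virasoro_bracket \<theta> (e p) = 0" "virasoro_bracket \<theta> \<theta> = 0"
  unfolding virasoro_bracket_def e_def[of p] e_def[of q] \<theta>_def bilinear_ext_single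
  by (simp_all add: \<theta>_def)

end

(* The quasiassociativity law says that left multiplication by [a,b] is the commutator of the left
   multiplications by a and b, and it suffices to test it on the basis.  There the denominators
   disappear: in e_p * (e_q * e_r) the factor 1 + \<epsilon>(q + r) cancels from the e-coefficient,
   and it cancels from the \<theta>-coefficient, where q + r = -p, because the central cocycle
   factors as p (p + \<epsilon>) (p - 1/\<epsilon>) / 2. *)
theory Submission
  imports Defs
begin

context bilinear_algebra
begin

lemma mult_add_right: "mult x (y + z) = mult x y + mult x z"
  using linear_right[of x] by (rule module_hom.add[OF Vector_Spaces.linear.axioms(3)])

lemma mult_add_left: "mult (x + y) z = mult x z + mult y z"
  using linear_left[of z] by (rule module_hom.add[OF Vector_Spaces.linear.axioms(3)])

lemma mult_scale_right: "mult x (scale c y) = scale c (mult x y)"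
  using linear_right[of x] by (rule module_hom.scale[OF Vector_Spaces.linear.axioms(3)])

lemma mult_scale_left: "mult (scale c x) y = scale c (mult x y)"
  using linear_left[of y] by (rule module_hom.scale[OF Vector_Spaces.linear.axioms(3)])

lemma mult_zero_right: "mult x 0 = 0"
  using mult_scale_right[of x 0 0] by simp

lemma mult_zero_left: "mult 0 y = 0"
  using mult_scale_left[of 0 0 y] by simp

lemmas mult_bilinear = mult_add_right mult_add_left mult_scale_right mult_scale_left
  mult_zero_right mult_zero_left

text \<open>By bilinearity, induction over the span extends the agreement first in the second
  argument, then in the first. This serves to identify the commutator with the Virasoro
  bracket.\<close>

lemma mult_eq_on_spanning:
  assumes "bilinear_algebra scale mult'" and span: "span B = UNIV"
    and eq: "\<And>a b. a \<in> B \<Longrightarrow> b \<in> B \<Longrightarrow> mult a b = mult' a b"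
  shows "mult a b = mult' a b"
proof -
  interpret A': bilinear_algebra scale mult' by fact
  have 1: "mult a b = mult' a b" if "a \<in> B" for a b
  proof -
    have "b \<in> span B" using span by simp
    then show ?thesis
      by (induction rule: span_induct_alt) (simp_all add: that eq mult_bilinear A'.mult_bilinear)
  qed
  have "a \<in> span B" using span by simp
  then show ?thesis
    by (induction rule: span_induct_alt) (simp_all add: 1 mult_bilinear A'.mult_bilinear)
qed

lemma bilinear_algebra_commutator: "bilinear_algebra scale (commutator mult)"
  by unfold_locales
    (simp_all add: commutator_def mult_bilinear scale_right_diff_distrib)

lemma quasiassociative_algebra_if_spanning:
  assumes span: "span B = UNIV"
    and eq: "\<And>a b c. a \<in> B \<Longrightarrow> b \<in> B \<Longrightarrow> c \<in> B \<Longrightarrow>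
      mult a (mult b c) - mult b (mult a c) = mult (commutator mult a b) c"
  shows "quasiassociative_algebra scale mult"
proof -
  interpret C: bilinear_algebra scale "commutator mult" by (rule bilinear_algebra_commutator)
  \<comment> \<open>Moving the subtracted term across leaves only sums, so additivity and
    homogeneity in \<open>c\<close>, then \<open>b\<close>, then \<open>a\<close>, suffice for the
    three span inductions.\<close>
  let ?P = "\<lambda>a b c. mult a (mult b c) = mult b (mult a c) + mult (commutator mult a b) c"
  note bilin = mult_bilinear C.mult_bilinear scale_right_distrib
  have in_span: "x \<in> span B" for x using span by simp
  have 0: "?P a b c" if "a \<in> B" "b \<in> B" "c \<in> B" for a b c
    using eq[OF that] by (simp add: algebra_simps)
  have 1: "?P a b c" if "a \<in> B" "b \<in> B" for a b c
    using in_span[of c]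
    by (induction rule: span_induct_alt) (simp_all add: bilin 0[OF that])
  have 2: "?P a b c" if "a \<in> B" for a b c
    using in_span[of b]
    by (induction rule: span_induct_alt) (simp_all add: bilin 1[OF that])
  have 3: "?P a b c" for a b c
    using in_span[of a]
    by (induction rule: span_induct_alt) (simp_all add: bilin 2)
  have diff: "mult (x - y) z = mult x z - mult y z" for x y z
    using linear_left[of z] by (rule module_hom.diff[OF Vector_Spaces.linear.axioms(3)])
  show ?thesis
    by unfold_locales (use 3 in \<open>simp add: commutator_def diff algebra_simps\<close>)
qed

end

interpretation star: bilinear_algebra pscale "star \<epsilon>"
  unfolding star_def by (rule bilinear_algebra_bilinear_ext)

text \<open>A zero would make \<open>- n\<close> the inverse of \<epsilon>, hence an integer. Every
  denominator of the product has this shape.\<close>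

lemma one_plus_mult_of_int_neq_0:
  fixes \<epsilon> :: "'a::field"
  assumes "inverse \<epsilon> \<notin> \<int>"
  shows "1 + \<epsilon> * of_int n \<noteq> 0"
proof
  assume "1 + \<epsilon> * of_int n = 0"
  then have "\<epsilon> * of_int (- n) = 1" by (simp add: add_eq_0_iff)
  then have "inverse \<epsilon> = of_int (- n)" by (rule inverse_unique)
  with assms show False by (metis Ints_of_int)
qed

definition star_coeff :: "'a::field \<Rightarrow> int \<Rightarrow> int \<Rightarrow> 'a"
  where "star_coeff \<epsilon> p q = - (of_int q * (1 + \<epsilon> * of_int q) / (1 + \<epsilon> * of_int (p + q)))"

definition star_cocycle :: "'a::field \<Rightarrow> int \<Rightarrow> 'a"
  where "star_cocycle \<epsilon> p =
    1 / 2 * (of_int p ^ 3 - of_int p + (\<epsilon> - inverse \<epsilon>) * of_int p ^ 2)"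

lemma star_e_e:
  "star \<epsilon> (e p) (e q) =
    star_coeff \<epsilon> p q *\<^sub>v e (p + q) + (star_cocycle \<epsilon> p * kdelta0 (p + q)) *\<^sub>v \<theta>"
  by (simp add: star_basis star_coeff_def star_cocycle_def)

lemma star_theta_right: "star \<epsilon> x \<theta> = 0"
proof -
  have "x \<in> star.span (insert \<theta> (range e))" by (simp add: basis_span)
  then show ?thesis
    by (induction rule: star.span_induct_alt) (auto simp: star.mult_bilinear star_basis)
qed

lemma star_theta_left: "star \<epsilon> \<theta> x = 0"
proof -
  have "x \<in> star.span (insert \<theta> (range e))" by (simp add: basis_span)
  then show ?thesis
    by (induction rule: star.span_induct_alt) (auto simp: star.mult_bilinear star_basis)
qed

lemma commutator_star_theta:
  "commutator (star \<epsilon>) x \<theta> = 0" "commutator (star \<epsilon>) \<theta> x = 0"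
  by (simp_all add: commutator_def star_theta_left star_theta_right)

context
  fixes \<epsilon> :: "'a::field_char_0"
  assumes eps: "\<epsilon> \<noteq> 0" "inverse \<epsilon> \<notin> \<int>"
begin

lemmas denominator_neq_0 = one_plus_mult_of_int_neq_0[OF eps(2)]

text \<open>The numerators combine to p(1 + \<epsilon>p) - q(1 + \<epsilon>q) = (p - q)(1 +
  \<epsilon>(p + q)), and the denominator cancels.\<close>

lemma star_coeff_commutator: "star_coeff \<epsilon> p q - star_coeff \<epsilon> q p = of_int (p - q)"
  using denominator_neq_0[of "p + q"]
  by (simp add: star_coeff_def add.commute[of q p] divide_simps del: of_int_add)
     (simp add: algebra_simps)

lemma star_coeff_mult:
  "star_coeff \<epsilon> q r * star_coeff \<epsilon> p (q + r) =
    of_int r * (1 + \<epsilon> * of_int r) * of_int (q + r) / (1 + \<epsilon> * of_int (p + q + r))"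
  using denominator_neq_0[of "q + r"]
  by (simp add: star_coeff_def add.assoc del: of_int_add)

text \<open>After the cancellation all terms share r(1 + \<epsilon>r)/(1 + \<epsilon>(p + q + r));
  what remains is (q + r) - (p + r) = -(p - q).\<close>

lemma star_coeff_jacobi:
  "star_coeff \<epsilon> q r * star_coeff \<epsilon> p (q + r) - star_coeff \<epsilon> p r * star_coeff \<epsilon> q (p + r) =
    of_int (p - q) * star_coeff \<epsilon> (p + q) r"
  unfolding star_coeff_mult add.commute[of q p]
  unfolding star_coeff_def minus_divide_left times_divide_eq_right diff_divide_distrib[symmetric]
  \<comment> \<open>Each side is now a single fraction, so numerators and denominators are compared
    separately.\<close>
  by (rule arg_cong2[where f = "(/)"]) (simp_all add: algebra_simps)

text \<open>The root factor p - 1/\<epsilon> is written as -(1 + \<epsilon>(-p))/\<epsilon>, the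
  shape in which it meets a denominator of \<open>star_coeff\<close>.\<close>

lemma star_cocycle_eq:
  "star_cocycle \<epsilon> p = - (of_int p * (of_int p + \<epsilon>) * (1 + \<epsilon> * of_int (- p)) / (2 * \<epsilon>))"
  using eps(1) by (simp add: star_cocycle_def field_simps power2_eq_square power3_eq_cube)

lemma star_coeff_cocycle:
  assumes "p + q + r = 0"
  shows "star_coeff \<epsilon> q r * star_cocycle \<epsilon> p =
    of_int r * (1 + \<epsilon> * of_int r) * of_int p * (of_int p + \<epsilon>) / (2 * \<epsilon>)"
proof -
  \<comment> \<open>The denominator of \<open>star_coeff \<epsilon> q r\<close> thereby becomes the
    last factor of \<open>star_cocycle_eq\<close>; leaving \<open>of_int (- p)\<close> unexpanded
    lets the two cancel.\<close>
  have "q + r = - p" using assms by simp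
  then show ?thesis
    using denominator_neq_0[of "- p"] unfolding star_cocycle_eq star_coeff_def
    by (simp del: of_int_minus)
qed

text \<open>With r(1 + \<epsilon>r)/(2\<epsilon>) taken out, the left side is p(p + \<epsilon>) -
  q(q + \<epsilon>) = (p - q)(p + q + \<epsilon>). Since r = -(p + q), this is the factored cocycle
  at p + q times p - q.\<close>

lemma star_cocycle_jacobi:
  assumes "p + q + r = 0"
  shows "star_coeff \<epsilon> q r * star_cocycle \<epsilon> p - star_coeff \<epsilon> p r * star_cocycle \<epsilon> q =
    of_int (p - q) * star_cocycle \<epsilon> (p + q)"
proof -
  have r: "r = - (p + q)" using assms by simp
  have "q + p + r = 0" using assms by simp
  then show ?thesis
    unfolding star_coeff_cocycle[OF assms] star_coeff_cocycle[OF \<open>q + p + r = 0\<close>]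
    unfolding star_cocycle_eq diff_divide_distrib[symmetric] r
    using eps(1) by (simp add: field_simps)
qed

lemma commutator_star_e_e:
  "commutator (star \<epsilon>) (e p) (e q) =
    of_int (p - q) *\<^sub>v e (p + q) + ((of_int p ^ 3 - of_int p) * kdelta0 (p + q)) *\<^sub>v \<theta>"
proof -
  have "star_cocycle \<epsilon> p * kdelta0 (p + q) - star_cocycle \<epsilon> q * kdelta0 (q + p) =
      (of_int p ^ 3 - of_int p) * kdelta0 (p + q)"
  proof (cases "p + q = 0")
    case True
    then have "q = - p" by simp
    \<comment> \<open>The quadratic terms are even in p and cancel; the odd part p^3 - p doubles and
      absorbs the factor 1/2.\<close>
    then show ?thesis by (simp add: kdelta0_def star_cocycle_def field_simps)
  qed (simp add: kdelta0_def add.commute)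
  moreover have "commutator (star \<epsilon>) (e p) (e q) =
      (star_coeff \<epsilon> p q - star_coeff \<epsilon> q p) *\<^sub>v e (p + q) +
      (star_cocycle \<epsilon> p * kdelta0 (p + q) - star_cocycle \<epsilon> q * kdelta0 (q + p)) *\<^sub>v \<theta>"
    by (simp add: commutator_def star_e_e star.scale_left_diff_distrib add.commute[of q p])
  ultimately show ?thesis by (simp only: star_coeff_commutator)
qed

lemma commutator_star: "commutator (star \<epsilon>) = virasoro_bracket"
proof (intro ext)
  fix a b
  interpret C: bilinear_algebra pscale "commutator (star \<epsilon>)"
    by (rule star.bilinear_algebra_commutator)
  show "commutator (star \<epsilon>) a b = virasoro_bracket a b"
  proof (rule C.mult_eq_on_spanning[OF _ basis_span])
    show "bilinear_algebra pscale (virasoro_bracket :: 'a vspace \<Rightarrow> _)"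
      unfolding virasoro_bracket_def by (rule bilinear_algebra_bilinear_ext)
  qed (auto simp: commutator_star_e_e commutator_star_theta virasoro_bracket_basis)
qed

text \<open>The outer product kills the \<theta>-part of each inner product, so the identity splits
  into \<open>star_coeff_jacobi\<close> for the e-component and \<open>star_cocycle_jacobi\<close>
  for the \<theta>-component.\<close>

lemma star_quasiassociative_e:
  "star \<epsilon> (e p) (star \<epsilon> (e q) (e r)) - star \<epsilon> (e q) (star \<epsilon> (e p) (e r)) =
    star \<epsilon> (commutator (star \<epsilon>) (e p) (e q)) (e r)"
proof -
  \<comment> \<open>In nonzero total degree every term vanishes, so the cocycle identity is called
    on only for p + q + r = 0.\<close>
  have cocycle: "star_coeff \<epsilon> q r * star_cocycle \<epsilon> p * kdelta0 (p + q + r)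
      - star_coeff \<epsilon> p r * star_cocycle \<epsilon> q * kdelta0 (p + q + r) =
      of_int (p - q) * star_cocycle \<epsilon> (p + q) * kdelta0 (p + q + r)"
    using star_cocycle_jacobi[of p q r] by (simp add: kdelta0_def)
  have eqs: "p + (q + r) = p + q + r" "q + (p + r) = p + q + r" by simp_all
  have "star \<epsilon> (e p) (star \<epsilon> (e q) (e r)) - star \<epsilon> (e q) (star \<epsilon> (e p) (e r)) =
      (star_coeff \<epsilon> q r * star_coeff \<epsilon> p (q + r)
        - star_coeff \<epsilon> p r * star_coeff \<epsilon> q (p + r)) *\<^sub>v e (p + q + r) +
      (star_coeff \<epsilon> q r * star_cocycle \<epsilon> p * kdelta0 (p + q + r)
        - star_coeff \<epsilon> p r * star_cocycle \<epsilon> q * kdelta0 (p + q + r)) *\<^sub>v \<theta>"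
    by (simp add: star_e_e star.mult_bilinear star_theta_right eqs star.scale_right_distrib
        star.scale_left_diff_distrib mult.assoc del: of_int_add)
  also have "\<dots> = star \<epsilon> (commutator (star \<epsilon>) (e p) (e q)) (e r)"
    unfolding star_coeff_jacobi cocycle commutator_star_e_e
    by (simp add: star_e_e star.mult_bilinear star_theta_left star.scale_right_distrib mult.assoc
        del: of_int_diff)
  finally show ?thesis .
qed

lemma quasiassociative_algebra_star: "quasiassociative_algebra pscale (star \<epsilon>)"
  by (rule star.quasiassociative_algebra_if_spanning[OF basis_span])
    \<comment> \<open>Triples that contain \<theta> are trivial, since \<theta> annihilates
      everything on both sides.\<close>
    (auto simp: star_quasiassociative_e commutator_star_theta star_theta_left star_theta_right
      star.mult_zero_left star.mult_zero_right)

end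

theorem mainTheorem1:
  fixes \<epsilon> :: "'a::field_char_0"
  assumes "\<epsilon> \<noteq> 0" and "inverse \<epsilon> \<notin> \<int>"
  shows "quasiassociative_algebra pscale (star \<epsilon>)
    \<and> commutator (star \<epsilon>) = virasoro_bracket
    \<and> (\<forall>p q. commutator (star \<epsilon>) (e p) (e q) =
          of_int (p - q) *\<^sub>v e (p + q) + ((of_int p ^ 3 - of_int p) * kdelta0 (p + q)) *\<^sub>v \<theta>)
    \<and> (\<forall>p. commutator (star \<epsilon>) \<theta> (e p) = 0)"
  by (intro conjI allI quasiassociative_algebra_star[OF assms] commutator_star[OF assms]
      commutator_star_e_e[OF assms] commutator_star_theta(2))

end
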